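(* Let $\tilde P_c\in\mathbb R^n$ be a nonnegative power demand (i.e., $\tilde P_c\in\mathcal N$). Then $\tilde P_c$ is feasible (i.e., $\tilde P_c\in\mathcal F\cap\mathcal N$) if and only if $$\chi(\nu)^\top\tilde P_c\le\tfrac12\nu^\top V_L^*\qquad\text{for all }\nu\in\mathcal N_1. \qquad( * )$$ More explicitly, the inequality in $( * )$ is equivalent to $$\mathbf 1^\top\Big[\big([Y_{LL}^{-1}\nu]+Y_{LL}^{-1}[\nu]\big)^{-1}V_L^*\Big]^{-1}\tilde P_c\le\tfrac12\nu^\top V_L^* .$$ Similarly, $\tilde P_c$ is feasible under small perturbation (i.e., $\tilde P_c\in\operatorname{int}(\mathcal F)\cap\mathcal N$) if and only if the inequality in $( * )$ holds strictly for all $\nu\in\mathcal N_1$.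
   Context: Notation: $[x]=\operatorname{diag}(x_1,\dots,x_k)$ for a vector $x$; $\mathbf 1,\mathbf 0$ are the all-ones and all-zeros vectors; vector and matrix inequalities are element-wise. Setting: a DC power grid with $n\ge1$ loads and $m\ge1$ sources. Its Kirchhoff matrix $Y=\begin{pmatrix} Y_{LL} & Y_{LS} \\ Y_{SL} & Y_{SS} \end{pmatrix}\in\mathbb R^{(n+m)\times(n+m)}$ is the weighted Laplacian of a connected undirected graph with positive edge weights (symmetric, nonpositive off-diagonal entries, zero row sums), partitioned according to loads and sources, and the $n\times n$ matrix $Y_{LL}$ is irreducible; hence $Y_{LL}$ is symmetric positive definite with nonpositive off-diagonal entries and has an entrywise positive inverse. The source voltages $V_S\in\mathbb R^m$, $V_S>\mathbf 0$, are fixed. Put $\mathcal I_L^*=-Y_{LS}V_S$ (which satisfies $\mathcal I_L^*\ge\mathbf 0$, $\mathcal I_L^*\ne\mathbf 0$) and $V_L^*=Y_{LL}^{-1}\mathcal I_L^*$ (which satisfies $V_L^*>\mathbf 0$). For $V_L\in\mathbb R^n$ put $P_c(V_L)=[V_L]Y_{LL}(V_L^*-V_L)$. The set of feasible power demands is $\mathcal F=\{P_c(V_L): V_L\in\mathbb R^n,\ V_L>\mathbf 0\}$, with interior $\operatorname{int}(\mathcal F)$ in $\mathbb R^n$. $\mathcal N=\{\nu\in\mathbb R^n:\nu\ge\mathbf 0\}$ and $\mathcal N_1=\{\nu\in\mathcal N:\mathbf 1^\top\nu=1\}$. For $\mu\in\mathbb R^n$ put $g(\mu)=[\mu]Y_{LL}+[Y_{LL}\mu]$,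 and $\psi(\mu)=g(\mu)^{-1}[\mu]\mathcal I_L^*$ when $g(\mu)$ is a nonsingular M-matrix (a matrix with nonpositive off-diagonal entries whose eigenvalues all have nonnegative real part). For nonzero $\nu\in\mathcal N$ the matrix $g(Y_{LL}^{-1}\nu)$ is a nonsingular M-matrix, and one puts $\chi(\nu)=[\psi(Y_{LL}^{-1}\nu)]^{-1}Y_{LL}^{-1}\nu$. *)

theory Defs
  imports "HOL-Analysis.Analysis"
begin

text \<open>
  Loads are indexed by \<open>'n\<close>, sources by \<open>'m\<close>, and the nodes of the grid by \<open>'n + 'm\<close>.
  The library order \<open>\<le>\<close> on \<open>real ^ 'n\<close> is element-wise, but the library's \<open><\<close> is not the
  element-wise strict order (it means \<open>x \<le> y \<and> x \<noteq> y\<close>), so element-wise strict inequalities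
  are written out with components.
\<close>

definition diag :: "'a::zero ^ 'k \<Rightarrow> 'a ^ 'k ^ 'k"
  where "diag x = (\<chi> i j. if i = j then x $ i else 0)"

text \<open>Weighted graphs: an undirected edge appears in \<open>E\<close> in both orientations.\<close>

definition connected_weighted_graph :: "('v \<times> 'v) set \<Rightarrow> ('v \<Rightarrow> 'v \<Rightarrow> real) \<Rightarrow> bool"
  where "connected_weighted_graph E w \<longleftrightarrow>
    sym E \<and> irrefl E \<and>
    (\<forall>(i, j) \<in> E. w i j > 0 \<and> w i j = w j i) \<and>
    (\<forall>i j. (i, j) \<in> E\<^sup>*)"

definition weighted_laplacian :: "('v \<times> 'v) set \<Rightarrow> ('v \<Rightarrow> 'v \<Rightarrow> real) \<Rightarrow> real ^ 'v ^ 'v"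
  where "weighted_laplacian E w =
    (\<chi> i j. if i = j then (\<Sum>k | (i, k) \<in> E. w i k)
            else if (i, j) \<in> E then - w i j else 0)"

definition kirchhoff_matrix :: "real ^ 'v ^ 'v \<Rightarrow> bool"
  where "kirchhoff_matrix Y \<longleftrightarrow>
    (\<exists>E w. connected_weighted_graph E w \<and> Y = weighted_laplacian E w)"

text \<open>With this convention every \<open>1 \<times> 1\<close> matrix is irreducible.\<close>

definition irreducible_matrix :: "'a::zero ^ 'k ^ 'k \<Rightarrow> bool"
  where "irreducible_matrix A \<longleftrightarrow>
    \<not> (\<exists>S. S \<noteq> {} \<and> S \<noteq> UNIV \<and> (\<forall>i\<in>S. \<forall>j\<in>-S. A $ i $ j = 0))"

definition complex_eigenvalue :: "real ^ 'k ^ 'k \<Rightarrow> complex \<Rightarrow> bool"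
  where "complex_eigenvalue A l \<longleftrightarrow>
    (\<exists>v. v \<noteq> 0 \<and> map_matrix complex_of_real A *v v = l *s v)"

definition M_matrix :: "real ^ 'k ^ 'k \<Rightarrow> bool"
  where "M_matrix A \<longleftrightarrow>
    (\<forall>i j. i \<noteq> j \<longrightarrow> A $ i $ j \<le> 0) \<and>
    (\<forall>l. complex_eigenvalue A l \<longrightarrow> 0 \<le> Re l)"

definition Y_LL :: "real ^ ('n::finite + 'm::finite) ^ ('n + 'm) \<Rightarrow> real ^ 'n ^ 'n"
  where "Y_LL Y = (\<chi> i j. Y $ Inl i $ Inl j)"

definition Y_LS :: "real ^ ('n::finite + 'm::finite) ^ ('n + 'm) \<Rightarrow> real ^ 'm ^ 'n"
  where "Y_LS Y = (\<chi> i j. Y $ Inl i $ Inr j)"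

definition I_L_star :: "real ^ ('n::finite + 'm::finite) ^ ('n + 'm) \<Rightarrow> real ^ 'm \<Rightarrow> real ^ 'n"
  where "I_L_star Y V_S = - (Y_LS Y *v V_S)"

definition V_L_star :: "real ^ ('n::finite + 'm::finite) ^ ('n + 'm) \<Rightarrow> real ^ 'm \<Rightarrow> real ^ 'n"
  where "V_L_star Y V_S = matrix_inv (Y_LL Y) *v I_L_star Y V_S"

definition P_c :: "real ^ ('n::finite + 'm::finite) ^ ('n + 'm) \<Rightarrow> real ^ 'm \<Rightarrow> real ^ 'n \<Rightarrow> real ^ 'n"
  where "P_c Y V_S V_L = diag V_L *v (Y_LL Y *v (V_L_star Y V_S - V_L))"

definition feasible_demands :: "real ^ ('n::finite + 'm::finite) ^ ('n + 'm) \<Rightarrow> real ^ 'm \<Rightarrow> (real ^ 'n) set"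
  where "feasible_demands Y V_S = {P_c Y V_S V_L | V_L. \<forall>i. 0 < V_L $ i}"

definition nonneg_vecs :: "(real ^ 'n) set"
  where "nonneg_vecs = {\<nu>. 0 \<le> \<nu>}"

definition nonneg_vecs_1 :: "(real ^ 'n) set"
  where "nonneg_vecs_1 = {\<nu> \<in> nonneg_vecs. 1 \<bullet> \<nu> = 1}"

definition g_mat :: "real ^ ('n::finite + 'm::finite) ^ ('n + 'm) \<Rightarrow> real ^ 'n \<Rightarrow> real ^ 'n ^ 'n"
  where "g_mat Y \<mu> = diag \<mu> ** Y_LL Y + diag (Y_LL Y *v \<mu>)"

text \<open>\<open>\<psi>\<close> is a partial function; nothing is specified about it outside its domain.\<close>

definition psi :: "real ^ ('n::finite + 'm::finite) ^ ('n + 'm) \<Rightarrow> real ^ 'm \<Rightarrow> real ^ 'n \<Rightarrow> real ^ 'n"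
  where "psi Y V_S \<mu> =
    (if invertible (g_mat Y \<mu>) \<and> M_matrix (g_mat Y \<mu>)
     then matrix_inv (g_mat Y \<mu>) *v (diag \<mu> *v I_L_star Y V_S)
     else undefined)"

text \<open>Only meaningful for nonzero \<open>\<nu> \<in> nonneg_vecs\<close>.\<close>

definition chi :: "real ^ ('n::finite + 'm::finite) ^ ('n + 'm) \<Rightarrow> real ^ 'm \<Rightarrow> real ^ 'n \<Rightarrow> real ^ 'n"
  where "chi Y V_S \<nu> =
    matrix_inv (diag (psi Y V_S (matrix_inv (Y_LL Y) *v \<nu>))) *v (matrix_inv (Y_LL Y) *v \<nu>)"

end

theory Submission
  imports Defs
begin

text \<open>
  Let \<open>A = Y_LL\<close>, \<open>b = I_L_star\<close>, \<open>\<mu> = A\<inverse> \<nu>\<close>, \<open>x = \<psi>(\<mu>)\<close> and \<open>\<lambda>\<^sub>i = \<mu>\<^sub>i / x\<^sub>i\<close>, so that \<open>\<lambda> = \<chi>(\<nu>)\<close>. The defining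
  equation of \<open>x\<close> reads \<open>H x = [\<lambda>] b\<close> with \<open>H = [\<lambda>] A + A [\<lambda>]\<close>; as \<open>H\<close> is a symmetric Z-matrix with a positive
  supersolution it is positive semidefinite, and the concave function
  \<open>\<lambda> \<bullet> P_c(V) = V \<bullet> [\<lambda>] b - V \<bullet> H V / 2\<close> is maximal at \<open>V = x\<close>, with value \<open>\<nu> \<bullet> V_L_star / 2\<close>. This
  gives necessity. Conversely, if \<open>P \<ge> 0\<close> is infeasible, let \<open>s P\<close> be the last feasible point on the ray through
  \<open>P\<close>, attained at \<open>x\<close>. The symmetrised Jacobian \<open>A - [s P\<^sub>i / x\<^sub>i\<^sup>2]\<close> has a positive Perron eigenvector
  \<open>\<mu>\<close>, and its eigenvalue is zero, since otherwise moving \<open>x\<close> along \<open>\<mu>\<close> would strictly dominate \<open>s P\<close>. Then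
  \<open>\<nu> = A \<mu> \<ge> 0\<close> and \<open>x = \<psi>(\<mu>)\<close>, so equality holds at \<open>s P\<close> and the inequality fails at \<open>P\<close>.
  For the interior the same dichotomy applies at \<open>P\<close> itself: strict inequalities exclude a zero Perron eigenvalue,
  so \<open>P\<close> is strictly dominated, and any demand dominated by a feasible one is feasible.
\<close>

subsection \<open>Irreducible symmetric Z-matrices\<close>

lemma diag_mult_nth [simp]: "(diag d *v x) $ i = d $ i * (x $ i :: real)"
  by (simp add: diag_def matrix_vector_mult_def if_distrib[of "\<lambda>a. a * _"] sum.delta cong: if_cong)

lemma inner_sum: "x \<bullet> y = (\<Sum>i\<in>UNIV. x $ i * y $ i)" for x y :: "real ^ 'k"
  by (simp add: inner_vec_def)

lemma matrix_inv_left: "invertible A \<Longrightarrow> matrix_inv A ** A = mat 1" for A :: "real ^ 'k ^ 'k"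
  unfolding invertible_def matrix_inv_def by (rule someI2_ex) auto

lemma diag_cancel:
  fixes d :: "real ^ 'k"
  assumes "\<And>i. d $ i \<noteq> 0"
  shows "invertible (diag d)" "matrix_inv (diag d) *v x = (\<chi> i. x $ i / d $ i)"
proof -
  have l: "diag (\<chi> i. inverse (d $ i)) ** diag d = mat 1"
    using assms by (simp add: matrix_eq vec_eq_iff flip: matrix_vector_mul_assoc)
  then show inv: "invertible (diag d)"
    using invertible_left_inverse by blast
  have "matrix_inv (diag d) *v (diag d *v (\<chi> i. x $ i / d $ i)) = (\<chi> i. x $ i / d $ i)"
    using inv by (simp add: matrix_vector_mul_assoc matrix_inv_left)
  moreover have "diag d *v (\<chi> i. x $ i / d $ i) = x"
    using assms by (simp add: vec_eq_iff)
  ultimately show "matrix_inv (diag d) *v x = (\<chi> i. x $ i / d $ i)" by simp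
qed

lemma matrix_inv_eqI:
  fixes A :: "real ^ 'k ^ 'k"
  assumes "invertible A" "A *v x = y"
  shows "matrix_inv A *v y = x"
  using assms by (auto simp: matrix_vector_mul_assoc matrix_inv_left)

lemma symmetric_matrix_inner:
  fixes A :: "real ^ 'k ^ 'k"
  assumes "transpose A = A" shows "x \<bullet> (A *v y) = (A *v x) \<bullet> y"
  using assms by (metis dot_lmul_matrix transpose_matrix_vector)

section \<open>Z-matrices: sign patterns and quadratic forms\<close>

definition Z_matrix :: "real ^ 'k ^ 'k \<Rightarrow> bool"
  where "Z_matrix A \<longleftrightarrow> (\<forall>i j. i \<noteq> j \<longrightarrow> A $ i $ j \<le> 0)"

lemma irreducible_matrixD:
  assumes "irreducible_matrix A" "S \<noteq> {}" "S \<noteq> UNIV"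
  obtains i j where "i \<in> S" "j \<notin> S" "A $ i $ j \<noteq> 0"
proof -
  have "\<not> (\<forall>i\<in>S. \<forall>j\<in>-S. A $ i $ j = 0)"
    using assms(1)[unfolded irreducible_matrix_def not_ex, THEN spec, of S] assms(2,3) by simp
  then show ?thesis using that by blast
qed

lemma Z_matrix_add_diag: "Z_matrix A \<Longrightarrow> Z_matrix (A + diag d)"
  by (simp add: Z_matrix_def diag_def)

lemma irreducible_add_diag: "irreducible_matrix A \<Longrightarrow> irreducible_matrix (A + diag d)"
  for A :: "real ^ 'k ^ 'k"
  unfolding irreducible_matrix_def diag_def
  by (auto simp: if_distrib Ball_def split: if_splits)

lemma transpose_add_diag: "transpose A = A \<Longrightarrow> transpose (A + diag d) = A + diag d"
  for A :: "real ^ 'k ^ 'k"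
  by (auto simp: transpose_def diag_def vec_eq_iff)

text \<open>In a row where \<open>u\<close> vanishes, all terms of \<open>B *v u\<close> are
  nonpositive, so the sign condition makes each of them zero; the zero set of \<open>u\<close> is
  then cut off from its complement, against irreducibility. Asking for the sign only at zeros of
  \<open>u\<close> lets the lemma cover eigenvectors for eigenvalues of any sign.\<close>

lemma irreducible_Z_matrix_pos:
  fixes B :: "real ^ 'k ^ 'k"
  assumes Z: "Z_matrix B" and irr: "irreducible_matrix B"
    and u: "\<And>i. 0 \<le> u $ i" "u \<noteq> 0" and Bu: "\<And>i. u $ i = 0 \<Longrightarrow> 0 \<le> (B *v u) $ i"
  shows "0 < u $ i"
proof (rule ccontr)
  define S where "S = {i. u $ i = 0}"
  assume "\<not> 0 < u $ i"
  then have "i \<in> S" using u(1)[of i] by (simp add: S_def)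
  moreover have "S \<noteq> UNIV" using u(2) by (auto simp: S_def vec_eq_iff)
  moreover have "B $ i $ j = 0" if "i \<in> S" "j \<in> - S" for i j
  proof -
    have term_nonpos: "B $ i $ k * u $ k \<le> 0" for k
      using that(1) Z u(1)[of k] unfolding Z_matrix_def S_def
      by (cases "k = i") (auto intro: mult_nonpos_nonneg)
    then have "(\<Sum>k\<in>UNIV. B $ i $ k * u $ k) = 0"
      using Bu[of i] that(1) sum_nonpos[of UNIV "\<lambda>k. B $ i $ k * u $ k"]
      by (simp add: S_def matrix_vector_mult_def)
    then have "B $ i $ j * u $ j = 0"
      using sum_nonneg_eq_0_iff[of UNIV "\<lambda>k. - (B $ i $ k * u $ k)"] term_nonpos
      by (simp add: sum_negf)
    then show ?thesis using that(2) by (simp add: S_def)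
  qed
  ultimately show False using irr unfolding irreducible_matrix_def by blast
qed

text \<open>The ground-state representation of the form. Expanding each square gives twice a term of
  \<open>x \<bullet> (B *v x)\<close> minus two terms whose double sums agree; each of these double
  sums is the first sum on the right.\<close>

lemma quadratic_form_positive_vector:
  fixes B :: "real ^ 'k ^ 'k"
  assumes sym: "transpose B = B" and z: "\<And>i. 0 < z $ i"
  shows "x \<bullet> (B *v x) = (\<Sum>i\<in>UNIV. (B *v z) $ i * (x $ i)\<^sup>2 / z $ i)
    + (\<Sum>i\<in>UNIV. \<Sum>j\<in>UNIV. - B $ i $ j * z $ i * z $ j * (x $ i / z $ i - x $ j / z $ j)\<^sup>2) / 2"
proof -
  have s: "B $ i $ j = B $ j $ i" for i j
    using sym by (metis transpose_def vec_lambda_beta)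
  let ?T = "\<lambda>i j. B $ i $ j * z $ j * (x $ i)\<^sup>2 / z $ i"
  have "- B $ i $ j * z $ i * z $ j * (x $ i / z $ i - x $ j / z $ j)\<^sup>2
      = 2 * (x $ i * (B $ i $ j * x $ j)) - ?T i j - ?T j i" for i j
    using z[of i] z[of j] s[of i j] by (simp add: field_simps power2_eq_square)
  then have "(\<Sum>i\<in>UNIV. \<Sum>j\<in>UNIV. - B $ i $ j * z $ i * z $ j * (x $ i / z $ i - x $ j / z $ j)\<^sup>2)
     = 2 * (\<Sum>i\<in>UNIV. \<Sum>j\<in>UNIV. x $ i * (B $ i $ j * x $ j))
       - (\<Sum>i\<in>UNIV. \<Sum>j\<in>UNIV. ?T i j) - (\<Sum>i\<in>UNIV. \<Sum>j\<in>UNIV. ?T j i)"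
    by (simp add: sum_subtractf sum_distrib_left)
  moreover have "(\<Sum>i\<in>UNIV. \<Sum>j\<in>UNIV. ?T j i) = (\<Sum>i\<in>UNIV. \<Sum>j\<in>UNIV. ?T i j)"
    by (rule sum.swap)
  moreover have "(\<Sum>i\<in>UNIV. \<Sum>j\<in>UNIV. ?T i j) = (\<Sum>i\<in>UNIV. (B *v z) $ i * (x $ i)\<^sup>2 / z $ i)"
    by (simp add: matrix_vector_mult_def sum_distrib_right sum_divide_distrib)
  moreover have "x \<bullet> (B *v x) = (\<Sum>i\<in>UNIV. \<Sum>j\<in>UNIV. x $ i * (B $ i $ j * x $ j))"
    by (simp add: inner_sum matrix_vector_mult_def sum_distrib_left)
  ultimately show ?thesis by (simp add: diff_divide_distrib)
qed

lemma Z_matrix_edge_nonneg: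
  fixes B :: "real ^ 'k ^ 'k"
  assumes "Z_matrix B" "\<And>i. 0 < z $ i"
  shows "0 \<le> - B $ i $ j * z $ i * z $ j * (x $ i / z $ i - x $ j / z $ j)\<^sup>2"
proof (cases "i = j")
  case False
  then have "0 \<le> - B $ i $ j" using assms(1) by (simp add: Z_matrix_def)
  then show ?thesis using assms(2)
    by (intro mult_nonneg_nonneg) (auto simp: less_imp_le)
qed simp

lemma Z_matrix_positive_semidefinite:
  fixes B :: "real ^ 'k ^ 'k"
  assumes "transpose B = B" "Z_matrix B" "\<And>i. 0 < z $ i" "\<And>i. 0 \<le> (B *v z) $ i"
  shows "0 \<le> x \<bullet> (B *v x)"
  unfolding quadratic_form_positive_vector[of B z, OF assms(1,3)]
  using Z_matrix_edge_nonneg[OF assms(2,3)] assms(3,4)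
  by (intro add_nonneg_nonneg divide_nonneg_pos sum_nonneg) (auto intro!: divide_nonneg_pos)

text \<open>If the form vanished, every summand of the ground-state representation would be zero.
  The first sum kills \<open>x\<close> at a node where \<open>B *v z\<close> is nonzero, and the
  squares spread this zero along the nonzero entries of \<open>B\<close>, so irreducibility gives
  \<open>x = 0\<close>.\<close>

lemma irreducible_Z_matrix_positive_definite:
  fixes B :: "real ^ 'k ^ 'k"
  assumes sym: "transpose B = B" and Z: "Z_matrix B" and irr: "irreducible_matrix B"
    and z: "\<And>i. 0 < z $ i" and Bz: "\<And>i. 0 \<le> (B *v z) $ i" "B *v z \<noteq> 0" and x: "x \<noteq> 0"
  shows "0 < x \<bullet> (B *v x)"
proof (rule ccontr)
  assume "\<not> 0 < x \<bullet> (B *v x)"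
  let ?D = "\<lambda>i. (B *v z) $ i * (x $ i)\<^sup>2 / z $ i"
  let ?E = "\<lambda>i j. - B $ i $ j * z $ i * z $ j * (x $ i / z $ i - x $ j / z $ j)\<^sup>2"
  have D: "0 \<le> ?D i" for i using z Bz(1) by (intro divide_nonneg_pos mult_nonneg_nonneg) auto
  have E: "0 \<le> ?E i j" for i j using Z_matrix_edge_nonneg[OF Z z] .
  have "0 \<le> (\<Sum>i\<in>UNIV. ?D i)" "0 \<le> (\<Sum>i\<in>UNIV. \<Sum>j\<in>UNIV. ?E i j)"
    using D E by (intro sum_nonneg; blast)+
  moreover have "(\<Sum>i\<in>UNIV. ?D i) + (\<Sum>i\<in>UNIV. \<Sum>j\<in>UNIV. ?E i j) / 2 \<le> 0"
    using \<open>\<not> 0 < x \<bullet> (B *v x)\<close> quadratic_form_positive_vector[of B z x, OF sym z] by linarith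
  ultimately have "(\<Sum>i\<in>UNIV. ?D i) = 0" "(\<Sum>i\<in>UNIV. \<Sum>j\<in>UNIV. ?E i j) = 0" by linarith+
  then have D0: "?D i = 0" and E0: "?E i j = 0" for i j
    using D E by (auto simp: sum_nonneg_eq_0_iff sum_nonneg simp del: mult_minus_left)
  obtain k where k: "(B *v z) $ k \<noteq> 0" using Bz(2) by (auto simp: vec_eq_iff)
  have xk: "x $ k = 0" using D0[of k] k z[of k] by auto
  define S where "S = {i. x $ i = 0}"
  have "B $ i $ j = 0" if "i \<in> S" "j \<in> - S" for i j
    using E0[of i j] that z[of i] z[of j] by (auto simp: S_def)
  moreover have "k \<in> S" using xk by (simp add: S_def)
  moreover have "S \<noteq> UNIV" using x by (auto simp: S_def vec_eq_iff)
  ultimately show False using irr unfolding irreducible_matrix_def by blast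
qed

section \<open>Irreducible Stieltjes matrices: positive definite symmetric Z-matrices\<close>

definition irreducible_stieltjes :: "real ^ 'k ^ 'k \<Rightarrow> bool"
  where "irreducible_stieltjes A \<longleftrightarrow> transpose A = A \<and> Z_matrix A \<and> irreducible_matrix A \<and>
    (\<forall>x. x \<noteq> 0 \<longrightarrow> 0 < x \<bullet> (A *v x))"

lemma irreducible_stieltjes_add_diag:
  assumes "irreducible_stieltjes A" "\<And>i. 0 \<le> d $ i"
  shows "irreducible_stieltjes (A + diag d)"
proof -
  have "0 < x \<bullet> ((A + diag d) *v x)" if "x \<noteq> 0" for x
  proof -
    have "0 \<le> x \<bullet> (diag d *v x)"
      using assms(2) by (auto simp: inner_sum mult.left_commute intro!: sum_nonneg)
    then show ?thesis using assms(1) that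
      by (simp add: irreducible_stieltjes_def matrix_vector_mult_add_rdistrib inner_add_right add_pos_nonneg)
  qed
  then show ?thesis using assms(1)
    by (simp add: irreducible_stieltjes_def transpose_add_diag Z_matrix_add_diag irreducible_add_diag)
qed

lemma irreducible_stieltjes_invertible:
  assumes "irreducible_stieltjes A" shows "invertible A"
proof -
  have "x = 0" if "A *v x = 0" for x
    using assms that unfolding irreducible_stieltjes_def by (metis inner_zero_right less_irrefl)
  then show ?thesis
    using invertible_left_inverse matrix_left_invertible_ker by blast
qed

text \<open>A maximum principle, giving positivity of the inverse. The negative part
  \<open>n\<close> of \<open>u\<close> satisfies \<open>n \<bullet> (A *v n) \<le> 0\<close>,
  because the positive and negative parts have disjoint supports and off-diagonal entries are
  nonpositive; hence \<open>n = 0\<close>, and irreducibility makes positivity strict.\<close>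

lemma irreducible_stieltjes_pos:
  assumes A: "irreducible_stieltjes A" and Au: "\<And>i. 0 \<le> (A *v u) $ i" "u \<noteq> 0"
  shows "0 < u $ i"
proof -
  define p where "p = (\<chi> i. max (u $ i) 0)"
  define n where "n = (\<chi> i. max (- u $ i) 0)"
  have Z: "Z_matrix A" using A by (simp add: irreducible_stieltjes_def)
  have "u = p - n" by (simp add: vec_eq_iff p_def n_def max_def)
  then have "n \<bullet> (A *v n) = n \<bullet> (A *v p) - n \<bullet> (A *v u)"
    by (simp add: matrix_vector_mult_diff_distrib inner_diff_right)
  moreover have "0 \<le> n \<bullet> (A *v u)"
    using Au(1) by (auto simp: inner_sum n_def intro!: sum_nonneg)
  moreover have "n \<bullet> (A *v p) \<le> 0"
  proof -
    have "n $ i * (A $ i $ j * p $ j) \<le> 0" for i j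
    proof (cases "i = j")
      case False
      then have "A $ i $ j \<le> 0" using Z by (simp add: Z_matrix_def)
      moreover have "0 \<le> n $ i" "0 \<le> p $ j" by (auto simp: n_def p_def)
      ultimately show ?thesis by (simp add: mult_nonneg_nonpos mult_nonpos_nonneg)
    qed (simp add: n_def p_def max_def)
    then show ?thesis
      by (simp add: inner_sum matrix_vector_mult_def sum_distrib_left sum_nonpos)
  qed
  ultimately have "\<not> 0 < n \<bullet> (A *v n)" by linarith
  then have "n = 0" using A by (auto simp: irreducible_stieltjes_def)
  then have "0 \<le> u $ i" for i
    by (simp add: n_def vec_eq_iff) (metis max.absorb_iff2 neg_le_0_iff_le)
  then show ?thesis
    using irreducible_Z_matrix_pos[of A u] A Au by (simp add: irreducible_stieltjes_def)
qed

section \<open>Perron eigenvectors and M-matrices\<close>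

lemma linear_coefficient_zero:
  fixes a c :: real
  assumes "\<And>t. 0 \<le> 2 * t * a + t\<^sup>2 * c"
  shows "a = 0"
proof (rule ccontr)
  assume "a \<noteq> 0"
  \<comment> \<open>At \<open>t = - e * a\<close> the quadratic equals
    \<open>e * a\<^sup>2 * (e * c - 2)\<close>, negative once \<open>e * c < 2\<close>.\<close>
  define e where "e = 1 / (1 + \<bar>c\<bar>)"
  have e: "0 < e" "e * c \<le> 1" by (auto simp: e_def field_simps)
  have "2 * (- e * a) * a + (- e * a)\<^sup>2 * c = e * a\<^sup>2 * (e * c - 2)"
    by (simp add: algebra_simps power2_eq_square)
  moreover have "e * a\<^sup>2 * (e * c - 2) < 0"
    using e \<open>a \<noteq> 0\<close> by (intro mult_pos_neg) auto
  ultimately show False using assms[of "- e * a"] by linarith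
qed

text \<open>Minimise the quadratic form on the unit sphere. Replacing a minimiser by its entrywise
  absolute values does not increase the form, since off-diagonal entries are nonpositive; a
  minimiser is an eigenvector, and irreducibility makes the nonnegative one positive.\<close>

lemma Perron_eigenvector:
  fixes A :: "real ^ 'k ^ 'k"
  assumes sym: "transpose A = A" and Z: "Z_matrix A" and irr: "irreducible_matrix A"
  obtains u l where "\<And>i. 0 < u $ i" "A *v u = l *\<^sub>R u"
proof -
  let ?q = "\<lambda>x. x \<bullet> (A *v x)"
  have cont: "continuous_on (sphere 0 1) ?q"
    by (intro continuous_intros linear_continuous_on) (simp add: linear_linear)
  have "\<exists>x::real^'k. norm x = 1" by (rule exI[of _ "axis undefined 1"]) (simp add: norm_axis_1)
  then have "sphere 0 1 \<noteq> ({} :: (real^'k) set)" by auto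
  then obtain v where v: "norm v = 1" "\<And>x. norm x = 1 \<Longrightarrow> ?q v \<le> ?q x"
    using continuous_attains_inf[OF compact_sphere _ cont] by auto
  define l where "l = ?q v"
  define u where "u = (\<chi> i. \<bar>v $ i\<bar>)"
  have "u \<bullet> u = 1" using v(1) by (simp add: inner_sum u_def norm_eq_1)
  then have u1: "norm u = 1" by (simp add: norm_eq_1)
  have "?q u \<le> ?q v"
  proof -
    have "u $ i * (A $ i $ j * u $ j) \<le> v $ i * (A $ i $ j * v $ j)" for i j
    proof (cases "i = j")
      case False
      then have a: "A $ i $ j \<le> 0" using Z by (simp add: Z_matrix_def)
      have "v $ i * v $ j \<le> \<bar>v $ i\<bar> * \<bar>v $ j\<bar>" by (metis abs_ge_self abs_mult)
      from mult_left_mono_neg[OF this a] show ?thesis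
        by (simp add: u_def algebra_simps)
    qed (simp add: u_def algebra_simps flip: power2_eq_square)
    then show ?thesis
      by (simp add: inner_sum matrix_vector_mult_def sum_distrib_left sum_mono)
  qed
  then have qu: "?q u = l" using v(2)[OF u1] by (simp add: l_def)
  have ray: "l * (x \<bullet> x) \<le> ?q x" for x
  proof (cases "x = 0")
    case False
    have "l \<le> ?q (x /\<^sub>R norm x)" unfolding l_def using False by (intro v(2)) simp
    also have "\<dots> = ?q x / (x \<bullet> x)"
      by (simp add: scaleR_matrix_vector_assoc[symmetric] matrix_vector_mult_scaleR power2_norm_eq_inner[symmetric] power2_eq_square divide_simps)
    finally show ?thesis using False by (simp add: field_simps)
  qed simp
  \<comment> \<open>The residual of the eigenvector equation, used as its own test direction: the
    first-order change of the form minus \<open>l\<close> times the squared norm along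
    \<open>h\<close> is \<open>2 * (h \<bullet> h)\<close>, which minimality forces to be
    zero.\<close>
  define h where "h = A *v u - l *\<^sub>R u"
  have symq: "h \<bullet> (A *v u) = u \<bullet> (A *v h)"
    using symmetric_matrix_inner[OF sym, of u h] by (simp add: inner_commute)
  have "0 \<le> 2 * t * (h \<bullet> h) + t\<^sup>2 * (?q h - l * (h \<bullet> h))" for t
  proof -
    have "h \<bullet> h = h \<bullet> (A *v u) - l * (u \<bullet> h)"
      by (subst (2) h_def) (simp add: inner_diff_right inner_commute)
    then have hAu: "h \<bullet> (A *v u) = h \<bullet> h + l * (u \<bullet> h)" "u \<bullet> (A *v h) = h \<bullet> h + l * (u \<bullet> h)"
      using symq by simp_all
    have "0 \<le> ?q (u + t *\<^sub>R h) - l * ((u + t *\<^sub>R h) \<bullet> (u + t *\<^sub>R h))"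
      using ray[of "u + t *\<^sub>R h"] by simp
    also have "\<dots> = 2 * t * (h \<bullet> h) + t\<^sup>2 * (?q h - l * (h \<bullet> h))"
      using hAu qu \<open>u \<bullet> u = 1\<close>
      by (simp add: inner_commute[of h u] algebra_simps power2_eq_square)
    finally show ?thesis .
  qed
  from linear_coefficient_zero[OF this] have eig: "A *v u = l *\<^sub>R u" by (simp add: h_def)
  moreover have "0 < u $ i" for i
    using u1 by (intro irreducible_Z_matrix_pos[OF Z irr]) (auto simp: u_def[THEN arg_cong[where f="\<lambda>v. v $ _"]] eig)
  ultimately show ?thesis using that by blast
qed

text \<open>The product need not be symmetric, so its eigenvalues are a priori complex. Dividing row
  \<open>i\<close> of the eigenvalue equation by \<open>d $ i\<close> and pairing with the conjugate
  of \<open>v = x + i y\<close> isolates \<open>Re l\<close> times a nonnegative weight; the other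
  side is the form of \<open>B\<close> at \<open>x\<close> plus that at \<open>y\<close>.\<close>

lemma M_matrix_diag_mult_stieltjes:
  fixes B :: "real ^ 'k ^ 'k"
  assumes B: "irreducible_stieltjes B" and d: "\<And>i. 0 < d $ i"
  shows "M_matrix (diag d ** B)"
proof -
  have entry: "(diag d ** B) $ i $ j = d $ i * B $ i $ j" for i j
    by (simp add: diag_def matrix_matrix_mult_def if_distrib[of "\<lambda>a. a * _"] sum.delta cong: if_cong)
  have "0 \<le> Re l" if l: "complex_eigenvalue (diag d ** B) l" for l
  proof -
    obtain v where v: "v \<noteq> 0" and ev: "map_matrix complex_of_real (diag d ** B) *v v = l *s v"
      using l unfolding complex_eigenvalue_def by blast
    define x y where "x = (\<chi> i. Re (v $ i))" and "y = (\<chi> i. Im (v $ i))"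
    have comp: "of_real (d $ i) * (\<Sum>j\<in>UNIV. of_real (B $ i $ j) * v $ j) = l * v $ i" for i
      using ev[THEN arg_cong[where f="\<lambda>v. v $ i"]]
      by (simp add: matrix_vector_mult_def map_matrix_def entry sum_distrib_left mult.assoc)
    have re: "d $ i * (B *v x) $ i = Re l * x $ i - Im l * y $ i"
      and im: "d $ i * (B *v y) $ i = Re l * y $ i + Im l * x $ i" for i
      using comp[of i, THEN arg_cong[where f=Re]] comp[of i, THEN arg_cong[where f=Im]]
      by (simp_all add: matrix_vector_mult_def x_def y_def)
    have "x $ i * (B *v x) $ i + y $ i * (B *v y) $ i = Re l * (((x $ i)\<^sup>2 + (y $ i)\<^sup>2) / d $ i)" for i
    proof -
      have "d $ i * (x $ i * (B *v x) $ i + y $ i * (B *v y) $ i)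
          = x $ i * (d $ i * (B *v x) $ i) + y $ i * (d $ i * (B *v y) $ i)" by (simp add: algebra_simps)
      also have "\<dots> = Re l * ((x $ i)\<^sup>2 + (y $ i)\<^sup>2)"
        unfolding re im by (simp add: algebra_simps power2_eq_square)
      finally show ?thesis using d[of i] by (simp add: field_simps)
    qed
    then have "x \<bullet> (B *v x) + y \<bullet> (B *v y) = Re l * (\<Sum>i\<in>UNIV. ((x $ i)\<^sup>2 + (y $ i)\<^sup>2) / d $ i)"
      by (simp add: inner_sum sum_distrib_left flip: sum.distrib)
    moreover have "0 < x \<bullet> (B *v x) + y \<bullet> (B *v y)"
    proof -
      have "x \<noteq> 0 \<or> y \<noteq> 0" using v by (auto simp: x_def y_def vec_eq_iff complex_eq_iff)
      moreover have "0 \<le> z \<bullet> (B *v z)" for z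
        using B by (cases "z = 0") (auto simp: irreducible_stieltjes_def less_imp_le)
      ultimately show ?thesis using B
        by (auto simp: irreducible_stieltjes_def intro: add_pos_nonneg add_nonneg_pos)
    qed
    moreover have "0 \<le> (\<Sum>i\<in>UNIV. ((x $ i)\<^sup>2 + (y $ i)\<^sup>2) / d $ i)"
      using d by (intro sum_nonneg divide_nonneg_pos) auto
    ultimately show ?thesis by (simp add: zero_less_mult_iff)
  qed
  moreover have "(diag d ** B) $ i $ j \<le> 0" if "i \<noteq> j" for i j
    using B d[of i] that by (simp add: entry irreducible_stieltjes_def Z_matrix_def mult_nonneg_nonpos)
  ultimately show ?thesis by (simp add: M_matrix_def)
qed

subsection \<open>Duality for the power flow equation\<close>

locale power_flow =
  fixes A :: "real ^ 'k ^ 'k" and b :: "real ^ 'k"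
  assumes A: "irreducible_stieltjes A" and b_nonneg: "\<And>i. 0 \<le> b $ i" and b_nonzero: "b \<noteq> 0"
begin

text \<open>This is \<open>P_c\<close> with the product of \<open>Y_LL\<close> and
  \<open>V_L_star\<close> already evaluated to the current \<open>b\<close>.\<close>

definition demand :: "real ^ 'k \<Rightarrow> real ^ 'k"
  where "demand x = (\<chi> i. x $ i * (b $ i - (A *v x) $ i))"

definition feasible :: "real ^ 'k \<Rightarrow> bool"
  where "feasible p \<longleftrightarrow> (\<exists>x. (\<forall>i. 0 < x $ i) \<and> demand x = p)"

text \<open>\<open>x\<close> plays the role of \<open>\<psi>(\<mu>)\<close>, for \<open>\<mu>\<close> normalised by \<open>A \<mu> \<in> nonneg_vecs_1\<close>.\<close>

definition dual_pair :: "real ^ 'k \<Rightarrow> real ^ 'k \<Rightarrow> bool"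
  where "dual_pair \<mu> x \<longleftrightarrow> (\<forall>i. 0 < \<mu> $ i \<and> 0 < x $ i \<and> 0 \<le> (A *v \<mu>) $ i) \<and> 1 \<bullet> (A *v \<mu>) = 1 \<and>
    (\<forall>i. \<mu> $ i * (A *v x) $ i + (A *v \<mu>) $ i * x $ i = \<mu> $ i * b $ i)"

lemma A_sym: "transpose A = A" and A_Z: "Z_matrix A" and A_irr: "irreducible_matrix A"
  and A_inv: "invertible A"
  using A irreducible_stieltjes_invertible[OF A] by (auto simp: irreducible_stieltjes_def)

lemma A_self_adjoint: "x \<bullet> (A *v y) = (A *v x) \<bullet> y"
  by (rule symmetric_matrix_inner[OF A_sym])

lemma A_solve: obtains x where "A *v x = y"
  using A_inv by (metis invertible_def matrix_vector_mul_assoc matrix_vector_mul_lid)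

lemma A_monotone:
  assumes "\<And>i. (A *v x) $ i \<le> (A *v y) $ i" shows "x $ i \<le> y $ i"
  using irreducible_stieltjes_pos[OF A, of "y - x" i] assms
  by (cases "y - x = 0") (auto simp: matrix_vector_mult_diff_distrib)

lemma demand_nth: "demand x $ i = x $ i * (b $ i - (A *v x) $ i)"
  by (simp add: demand_def)

section \<open>Feasibility of dominated demands and along rays\<close>

lemma continuous_on_demand [continuous_intros]:
  "continuous_on S f \<Longrightarrow> continuous_on S (\<lambda>t. demand (f t))"
proof -
  have "continuous_on UNIV demand"
    unfolding demand_def
    by (intro continuous_on_vec_lambda continuous_intros)
  then show "continuous_on S f \<Longrightarrow> continuous_on S (\<lambda>t. demand (f t))"
    by (rule continuous_on_compose2) auto
qed

text \<open>Among the supersolutions of the demand equation above \<open>y\<close>, one with maximal entry sum is a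
  solution: raising an entry with strict inequality only raises the demand at the other nodes.\<close>

lemma feasible_if_le_demand:
  assumes y: "\<And>i. 0 < y $ i" and p: "\<And>i. p $ i \<le> demand y $ i"
  shows "feasible p"
proof -
  define S where "S = {x. \<forall>i. y $ i \<le> x $ i \<and> p $ i \<le> demand x $ i}"
  \<comment> \<open>Since \<open>x \<ge> y\<close> on \<open>S\<close>, each \<open>x\<close> in
    \<open>S\<close> satisfies \<open>A *v x \<le> c\<close>; comparison with the solution
    \<open>w\<close> of \<open>A *v w = c\<close> bounds \<open>S\<close>.\<close>
  define c where "c = (\<chi> i. b $ i + \<bar>p $ i\<bar> / y $ i)"
  obtain w where w: "A *v w = c" by (rule A_solve)
  have "x $ i \<le> w $ i" if "x \<in> S" for x i
  proof (rule A_monotone)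
    fix i
    have x: "y $ i \<le> x $ i" "p $ i \<le> x $ i * (b $ i - (A *v x) $ i)" "0 < x $ i"
      using that y[of i] by (auto simp: S_def demand_nth intro: less_le_trans)
    have "(A *v x) $ i \<le> b $ i - p $ i / x $ i" using x by (simp add: field_simps)
    also have "\<dots> \<le> b $ i + \<bar>p $ i\<bar> / x $ i" using x(3) by (simp add: divide_simps)
    also have "\<dots> \<le> b $ i + \<bar>p $ i\<bar> / y $ i"
      using x y[of i] by (simp add: frac_le)
    finally show "(A *v x) $ i \<le> (A *v w) $ i" by (simp add: w c_def)
  qed
  then have "S \<subseteq> cbox y w" by (auto simp: S_def mem_box_cart)
  then have "bounded S" using bounded_cbox bounded_subset by blast
  moreover have "closed S"
    unfolding S_def by (intro closed_Collect_all closed_Collect_conj closed_Collect_le continuous_intros)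
  ultimately have "compact S" by (simp add: compact_eq_bounded_closed)
  moreover have "y \<in> S" using p by (simp add: S_def)
  moreover have "continuous_on S (\<lambda>x. \<Sum>i\<in>UNIV. x $ i)" by (intro continuous_intros)
  ultimately obtain x where x: "x \<in> S" "\<And>z. z \<in> S \<Longrightarrow> (\<Sum>i\<in>UNIV. z $ i) \<le> (\<Sum>i\<in>UNIV. x $ i)"
    using continuous_attains_sup[of S "\<lambda>x. \<Sum>i\<in>UNIV. x $ i"] by blast
  have pos: "0 < x $ i" for i using x(1) y[of i] by (auto simp: S_def intro: less_le_trans)
  have "demand x $ i = p $ i" for i
  proof (rule ccontr)
    assume "demand x $ i \<noteq> p $ i"
    then have gt: "p $ i < demand x $ i" using x(1) by (auto simp: S_def order_less_le)
    let ?x = "\<lambda>t::real. x + t *\<^sub>R axis i 1"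
    have "continuous_on UNIV (\<lambda>t. demand (?x t) $ i)" by (intro continuous_intros)
    then have "((\<lambda>t. demand (?x t) $ i) \<longlongrightarrow> demand (?x 0) $ i) (at_right 0)"
      by (meson UNIV_I continuous_on_def filterlim_at_split filterlim_mono at_le order_refl subset_UNIV)
    then have "\<forall>\<^sub>F t in at_right 0. p $ i < demand (?x t) $ i"
      using gt by (intro order_tendstoD) auto
    then have "\<forall>\<^sub>F t in at_right 0. p $ i < demand (?x t) $ i \<and> 0 < t"
      using eventually_at_right_less eventually_conj by blast
    then obtain t where t: "p $ i < demand (?x t) $ i" "0 < t"
      by (metis (lifting) eventually_happens trivial_limit_at_right_real)
    have "p $ j \<le> demand (?x t) $ j" for j
    proof (cases "j = i")
      case False
      then have "A $ j $ i \<le> 0" using A_Z by (simp add: Z_matrix_def)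
      then have "(A *v ?x t) $ j \<le> (A *v x) $ j"
        using t(2) by (simp add: matrix_vector_right_distrib matrix_vector_mult_scaleR
            matrix_vector_mul_component matrix_vector_mult_basis column_def mult_nonneg_nonpos)
      then have "demand x $ j \<le> demand (?x t) $ j"
        using False pos[of j] by (simp add: demand_nth axis_def mult_left_mono)
      then show ?thesis using x(1) by (auto simp: S_def intro: order_trans)
    qed (use t in simp)
    moreover have "x $ j \<le> ?x t $ j" for j using t(2) by (simp add: axis_def)
    ultimately have "?x t \<in> S" using x(1) by (auto simp: S_def intro: order_trans)
    from x(2)[OF this] have "(\<Sum>j\<in>UNIV. t * axis i 1 $ j) \<le> 0"
      by (simp add: sum.distrib)
    then show False using t(2) by (simp add: axis_def if_distrib sum.delta cong: if_cong)
  qed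
  then show ?thesis unfolding feasible_def using pos by (metis vec_eq_iff)
qed

lemma feasible_zero: "feasible 0"
proof -
  \<comment> \<open>The open-circuit voltage, at which the loads draw no current.\<close>
  obtain x where x: "A *v x = b" by (rule A_solve)
  have "x \<noteq> 0" using x b_nonzero by auto
  then have "0 < x $ i" for i using irreducible_stieltjes_pos[OF A] x b_nonneg by metis
  moreover have "demand x = 0" by (simp add: demand_def x vec_eq_iff)
  ultimately show ?thesis by (auto simp: feasible_def)
qed

text \<open>Nonnegative demand means \<open>A *v X n \<le> b\<close>, so the voltages lie in a fixed
  box and a subsequence converges. The remaining issue is that the limit could have zero
  entries.\<close>

lemma closed_feasible_ray:
  assumes P: "\<And>i. 0 \<le> P $ i"
  shows "closed {t. 0 \<le> t \<and> feasible (t *\<^sub>R P)}"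
  unfolding closed_sequential_limits
proof (intro allI impI, elim conjE)
  fix t :: "nat \<Rightarrow> real" and l
  assume t: "\<forall>n. t n \<in> {t. 0 \<le> t \<and> feasible (t *\<^sub>R P)}" and lim: "t \<longlonglongrightarrow> l"
  have "0 \<le> l" using t lim by (intro LIMSEQ_le_const[OF lim]) auto
  moreover have "feasible (l *\<^sub>R P)" if "l \<noteq> 0"
  proof -
    obtain X where X: "\<And>n i. 0 < X n $ i" "\<And>n. demand (X n) = t n *\<^sub>R P"
      using t unfolding feasible_def mem_Collect_eq by metis
    obtain w where w: "A *v w = b" by (rule A_solve)
    have "X n \<in> cbox 0 w" for n
    proof -
      have "X n $ i \<le> w $ i" for i
      proof (rule A_monotone)
        fix i
        have "0 \<le> X n $ i * (b $ i - (A *v X n) $ i)"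
          using t P[of i] X(2)[of n, THEN arg_cong[where f="\<lambda>v. v $ i"]] by (simp add: demand_nth)
        then show "(A *v X n) $ i \<le> (A *v w) $ i"
          using X(1)[of n i] w by (simp add: zero_le_mult_iff)
      qed
      then show ?thesis using X(1) by (simp add: mem_box_cart less_imp_le)
    qed
    then obtain x r where xr: "x \<in> cbox 0 w" "strict_mono r" "(X \<circ> r) \<longlonglongrightarrow> x"
      using compact_cbox[of 0 w] unfolding compact_def by metis
    have "continuous_on UNIV demand" using continuous_on_demand[OF continuous_on_id] by simp
    then have "(\<lambda>n. demand ((X \<circ> r) n)) \<longlonglongrightarrow> demand x"
      using xr(3) by (intro continuous_on_tendsto_compose[where f=demand]) (auto simp del: o_apply)
    moreover have "(\<lambda>n. demand ((X \<circ> r) n)) \<longlonglongrightarrow> l *\<^sub>R P"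
      using LIMSEQ_subseq_LIMSEQ[OF lim xr(2)] by (auto simp: X(2) o_def intro!: tendsto_intros)
    ultimately have px: "demand x = l *\<^sub>R P" by (rule LIMSEQ_unique)
    \<comment> \<open>For \<open>l \<noteq> 0\<close> a zero of the limit voltage forces
      \<open>P $ i = 0\<close>. Then no current is drawn at \<open>i\<close> along the whole
      sequence, an equation that survives the limit and feeds the irreducibility argument. The case
      \<open>l = 0\<close> is \<open>feasible_zero\<close>.\<close>
    have Ax: "(A *v x) $ i = b $ i" if "x $ i = 0" for i
    proof -
      have "P $ i = 0"
        using px[THEN arg_cong[where f="\<lambda>v. v $ i"]] that \<open>l \<noteq> 0\<close> by (simp add: demand_nth)
      then have "(A *v X n) $ i = b $ i" for n
        using X(1)[of n i] X(2)[of n, THEN arg_cong[where f="\<lambda>v. v $ i"]] by (simp add: demand_nth)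
      moreover have "(\<lambda>n. (A *v (X \<circ> r) n) $ i) \<longlonglongrightarrow> (A *v x) $ i"
        using xr(3) by (intro tendsto_vec_nth continuous_on_tendsto_compose[where f="(*v) A" and s=UNIV]
            continuous_intros) (auto simp del: o_apply)
      ultimately show ?thesis using LIMSEQ_unique by (auto simp: LIMSEQ_const_iff)
    qed
    have "x \<noteq> 0" using Ax b_nonzero by (metis matrix_vector_mult_0_right vec_eq_iff zero_index)
    then have "0 < x $ i" for i
      using xr(1) Ax b_nonneg by (intro irreducible_Z_matrix_pos[OF A_Z A_irr]) (auto simp: mem_box_cart)
    then show ?thesis using px by (auto simp: feasible_def)
  qed
  ultimately show "l \<in> {t. 0 \<le> t \<and> feasible (t *\<^sub>R P)}"
    using feasible_zero by (cases "l = 0") auto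
qed

section \<open>Undominated demands and dual pairs\<close>

lemma uniform_small_step:
  fixes x c :: "real ^ 'k"
  assumes "\<And>i. 0 < x $ i"
  obtains e where "0 < e" "\<And>i. e * c $ i < x $ i"
proof -
  have "\<forall>\<^sub>F e in at_right 0. e * c $ i < x $ i" for i
  proof -
    have "((\<lambda>e. e * c $ i) \<longlongrightarrow> 0 * c $ i) (at_right 0)" by (intro tendsto_intros)
    then show ?thesis using assms by (intro order_tendstoD) auto
  qed
  then have "\<forall>\<^sub>F e in at_right 0. \<forall>i. e * c $ i < x $ i" by (rule eventually_all_finite)
  then have "\<forall>\<^sub>F e in at_right 0. (\<forall>i. e * c $ i < x $ i) \<and> 0 < e"
    using eventually_at_right_less eventually_conj by blast
  then show ?thesis using that
    by (metis (lifting) eventually_happens trivial_limit_at_right_real)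
qed

text \<open>The Jacobian of \<^term>\<open>demand\<close> at \<open>x\<close> is \<open>-diag x\<close> times the symmetric matrix \<open>J\<close> below. If its
  Perron eigenvalue were nonzero, moving \<open>x\<close> along the Perron eigenvector would raise all powers.\<close>

lemma dual_pair_if_not_dominated:
  assumes x: "\<And>i. 0 < x $ i" and p: "\<And>i. 0 \<le> demand x $ i"
    and max: "\<nexists>y. \<forall>i. 0 < y $ i \<and> demand x $ i < demand y $ i"
  obtains \<mu> where "dual_pair \<mu> x"
proof -
  \<comment> \<open>The derivative of \<open>demand\<close> at \<open>x\<close> along
    \<open>h\<close> has entries \<open>h_i * (b - A x)_i - x_i * (A h)_i\<close>; substituting
    \<open>(b - A x)_i = demand x_i / x_i\<close> and dividing by \<open>- x_i\<close> leaves
    \<open>A h + [d] h\<close>.\<close>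
  define d where "d = (\<chi> i. - demand x $ i / (x $ i)\<^sup>2)"
  define J where "J = A + diag d"
  have "transpose J = J" "Z_matrix J" "irreducible_matrix J"
    unfolding J_def by (simp_all add: A_sym A_Z A_irr transpose_add_diag Z_matrix_add_diag irreducible_add_diag)
  then obtain u l where u: "\<And>i. 0 < u $ i" and ev: "J *v u = l *\<^sub>R u"
    by (rule Perron_eigenvector) blast
  have Au: "(A *v u) $ i = l * u $ i + demand x $ i * u $ i / (x $ i)\<^sup>2" for i
    using ev[THEN arg_cong[where f="\<lambda>v. v $ i"]]
    by (simp add: J_def d_def matrix_vector_mult_add_rdistrib)
  have "l = 0"
  proof (rule ccontr)
    assume "l \<noteq> 0"
    obtain e1 where e1: "0 < e1" "\<And>i. e1 * \<bar>l * u $ i\<bar> < x $ i"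
      using uniform_small_step[OF x, of "\<chi> i. \<bar>l * u $ i\<bar>"] by auto
    obtain e2 where e2: "0 < e2" "\<And>i. e2 * \<bar>(A *v u) $ i\<bar> < x $ i"
      using uniform_small_step[OF x, of "\<chi> i. \<bar>(A *v u) $ i\<bar>"] by auto
    \<comment> \<open>The bound from \<open>e1\<close> keeps the moved voltage positive, the one
      from \<open>e2\<close> keeps the second-order term below the first-order gain.\<close>
    define e where "e = min e1 e2"
    have e: "0 < e" using e1(1) e2(1) by (simp add: e_def)
    have le: "e * c \<le> e1 * \<bar>c\<bar>" "e * c \<le> e2 * \<bar>c\<bar>" for c
    proof -
      have "e * c \<le> e * \<bar>c\<bar>" using e by (simp add: mult_left_mono)
      moreover have "e * \<bar>c\<bar> \<le> e1 * \<bar>c\<bar>" "e * \<bar>c\<bar> \<le> e2 * \<bar>c\<bar>"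
        by (simp_all add: e_def mult_right_mono)
      ultimately show "e * c \<le> e1 * \<bar>c\<bar>" "e * c \<le> e2 * \<bar>c\<bar>" by linarith+
    qed
    have el: "e * (l * u $ i) < x $ i" "e * (A *v u) $ i < x $ i" for i
      using le(1)[of "l * u $ i"] e1(2)[of i] le(2)[of "(A *v u) $ i"] e2(2)[of i] by linarith+
    \<comment> \<open>Including the factor \<open>l\<close> in the step makes the first-order gain
      \<open>e * l\<^sup>2 * u $ i * x $ i\<close>, positive for either sign of
      \<open>l\<close>.\<close>
    let ?y = "x - (e * l) *\<^sub>R u"
    have "0 < ?y $ i" for i using el(1)[of i] by (simp add: mult.assoc)
    moreover have "demand x $ i < demand ?y $ i" for i
    proof -
      define a r s where "a = (A *v u) $ i" and "r = b $ i - (A *v x) $ i" and "s = e * l"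
      have Pi: "demand x $ i = x $ i * r" by (simp add: demand_nth r_def)
      have a: "x $ i * a = l * (u $ i * x $ i) + r * u $ i"
        unfolding a_def Au Pi using x[of i] by (simp add: field_simps power2_eq_square)
      have "demand ?y $ i = (x $ i - s * u $ i) * (r + s * a)"
        by (simp add: demand_nth matrix_vector_mult_diff_distrib matrix_vector_mult_scaleR a_def r_def s_def algebra_simps)
      also have "\<dots> = x $ i * r + s * (x $ i * a - r * u $ i) - s\<^sup>2 * u $ i * a"
        by (simp add: algebra_simps power2_eq_square)
      also have "\<dots> = x $ i * r + e * l\<^sup>2 * u $ i * (x $ i - e * a)"
        unfolding a s_def by (simp add: algebra_simps power2_eq_square)
      finally have "demand ?y $ i = demand x $ i + e * l\<^sup>2 * u $ i * (x $ i - e * a)" by (simp add: Pi)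
      moreover have "0 < e * l\<^sup>2 * u $ i * (x $ i - e * a)"
        using e \<open>l \<noteq> 0\<close> u[of i] el(2)[of i] by (simp add: a_def)
      ultimately show ?thesis by simp
    qed
    ultimately show False using max by blast
  qed
  \<comment> \<open>With eigenvalue zero this equation is, after multiplication by
    \<open>x $ i\<close>, the defining equation of a dual pair; only the normalisation by
    \<open>c\<close> remains.\<close>
  then have Au: "(A *v u) $ i = demand x $ i * u $ i / (x $ i)\<^sup>2" for i using Au by simp
  then have Au0: "0 \<le> (A *v u) $ i" for i using p u[of i] by (simp add: less_imp_le)
  define c where "c = 1 \<bullet> (A *v u)"
  have "u \<noteq> 0" using u by (metis less_irrefl zero_index)
  then have "0 < u \<bullet> (A *v u)" using A by (simp add: irreducible_stieltjes_def)
  then have "A *v u \<noteq> 0" by auto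
  then obtain i where "(A *v u) $ i \<noteq> 0" by (auto simp: vec_eq_iff)
  then have c: "0 < c" unfolding c_def inner_sum
    using Au0 Au0[of i] by (intro sum_pos2[of UNIV i]) (auto simp: order_less_le)
  let ?m = "(1 / c) *\<^sub>R u"
  have "dual_pair ?m x"
    unfolding dual_pair_def
  proof (intro conjI allI)
    fix i
    show "?m $ i * (A *v x) $ i + (A *v ?m) $ i * x $ i = ?m $ i * b $ i"
      using x[of i] c by (simp add: matrix_vector_mult_scaleR Au demand_nth field_simps power2_eq_square)
  qed (use c u x Au0 in \<open>simp_all add: matrix_vector_mult_scaleR c_def\<close>)
  then show ?thesis by (rule that)
qed

text \<open>The left-hand side is a concave quadratic function of \<open>y\<close>, maximal at \<open>y = x\<close>.\<close>

lemma dual_pair_demand_bound: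
  assumes "dual_pair \<mu> x"
  shows "(\<Sum>i\<in>UNIV. \<mu> $ i / x $ i * demand y $ i) \<le> (\<mu> \<bullet> b) / 2"
    and "(\<Sum>i\<in>UNIV. \<mu> $ i / x $ i * demand x $ i) = (\<mu> \<bullet> b) / 2"
proof -
  have \<mu>: "0 < \<mu> $ i" and x: "0 < x $ i" and
    eq: "\<mu> $ i * (A *v x) $ i + (A *v \<mu>) $ i * x $ i = \<mu> $ i * b $ i" for i
    using assms by (auto simp: dual_pair_def)
  define L where "L = diag (\<chi> i. \<mu> $ i / x $ i)"
  define H where "H = L ** A + A ** L"
  have Lsa: "v \<bullet> (L *v w) = (L *v v) \<bullet> w" for v w
    by (simp add: L_def inner_sum algebra_simps)
  have Hv: "H *v v = L *v (A *v v) + A *v (L *v v)" for v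
    by (simp add: H_def matrix_vector_mult_add_rdistrib matrix_vector_mul_assoc)
  have Lx: "L *v x = \<mu>" using x by (simp add: L_def vec_eq_iff less_imp_neq[THEN not_sym])
  \<comment> \<open>The dual pair equation divided by \<open>x $ i\<close>. It makes
    \<open>x\<close> a critical point of the quadratic function, and also the positive supersolution
    behind semidefiniteness of \<open>H\<close>.\<close>
  have Hx: "H *v x = L *v b"
    unfolding Hv Lx using eq x by (simp add: L_def vec_eq_iff field_simps less_imp_neq[THEN not_sym])
  have entry: "H $ i $ j = \<mu> $ i / x $ i * A $ i $ j + A $ i $ j * (\<mu> $ j / x $ j)" for i j
    by (simp add: H_def L_def diag_def matrix_matrix_mult_def if_distrib[of "\<lambda>a. a * _"]
        if_distrib[of "\<lambda>a. _ * a"] sum.delta cong: if_cong)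
  have As: "A $ i $ j = A $ j $ i" for i j using A_sym by (metis transpose_def vec_lambda_beta)
  have Hsym: "transpose H = H"
    by (simp add: transpose_def vec_eq_iff entry As[of _ _] algebra_simps)
  moreover have "Z_matrix H"
    unfolding Z_matrix_def
  proof (intro allI impI)
    fix i j :: 'k assume "i \<noteq> j"
    then have "A $ i $ j \<le> 0" using A_Z by (simp add: Z_matrix_def)
    moreover have "0 \<le> \<mu> $ i / x $ i" "0 \<le> \<mu> $ j / x $ j" using \<mu> x by (simp_all add: less_imp_le)
    ultimately show "H $ i $ j \<le> 0"
      unfolding entry by (intro add_nonpos_nonpos mult_nonneg_nonpos mult_nonpos_nonneg)
  qed
  moreover have "0 \<le> (H *v x) $ i" for i
    using \<mu>[of i] x[of i] b_nonneg[of i] by (simp add: Hx L_def)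
  ultimately have psd: "0 \<le> v \<bullet> (H *v v)" for v
    using Z_matrix_positive_semidefinite x by blast
  have Hsa: "v \<bullet> (H *v w) = w \<bullet> (H *v v)" for v w
    using symmetric_matrix_inner[OF Hsym, of v w] by (simp add: inner_commute)
  have xHx: "x \<bullet> (H *v x) = \<mu> \<bullet> b" by (simp add: Hx Lsa Lx)
  \<comment> \<open>Completing the square around the critical point \<open>x\<close>.\<close>
  have sum: "(\<Sum>i\<in>UNIV. \<mu> $ i / x $ i * demand y $ i) = ((\<mu> \<bullet> b) - (y - x) \<bullet> (H *v (y - x))) / 2" for y
  proof -
    have "(\<Sum>i\<in>UNIV. \<mu> $ i / x $ i * demand y $ i) = y \<bullet> (L *v b) - y \<bullet> (L *v (A *v y))"
      by (simp add: inner_sum L_def demand_nth algebra_simps sum_subtractf)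
    moreover have "y \<bullet> (A *v (L *v y)) = y \<bullet> (L *v (A *v y))"
      by (simp only: A_self_adjoint[of y] Lsa[of "A *v y"]) (rule inner_commute)
    then have "y \<bullet> (H *v y) = 2 * (y \<bullet> (L *v (A *v y)))"
      by (simp add: Hv inner_add_right)
    moreover have "(y - x) \<bullet> (H *v (y - x)) = y \<bullet> (H *v y) - 2 * (y \<bullet> (H *v x)) + x \<bullet> (H *v x)"
      using Hsa[of x y] by (simp add: matrix_vector_mult_diff_distrib inner_diff_left inner_diff_right)
    ultimately show ?thesis using xHx by (simp add: Hx)
  qed
  show "(\<Sum>i\<in>UNIV. \<mu> $ i / x $ i * demand y $ i) \<le> (\<mu> \<bullet> b) / 2"
    unfolding sum using psd[of "y - x"] by simp
  show "(\<Sum>i\<in>UNIV. \<mu> $ i / x $ i * demand x $ i) = (\<mu> \<bullet> b) / 2"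
    unfolding sum by simp
qed

text \<open>Makes the bound positive, so that scaling a demand with equality by a factor above one
  violates the inequality.\<close>

lemma dual_pair_inner_pos:
  assumes "dual_pair \<mu> x" shows "0 < \<mu> \<bullet> b"
proof -
  obtain i where "b $ i \<noteq> 0" using b_nonzero by (auto simp: vec_eq_iff)
  then show ?thesis unfolding inner_sum
    using assms b_nonneg b_nonneg[of i] unfolding dual_pair_def
    by (intro sum_pos2[of UNIV i] mult_nonneg_nonneg mult_pos_pos) (auto simp: less_imp_le order_less_le)
qed

section \<open>Feasibility and interior feasibility as dual inequalities\<close>

theorem feasible_iff_dual:
  assumes P: "\<And>i. 0 \<le> P $ i"
  shows "feasible P \<longleftrightarrow> (\<forall>\<mu> x. dual_pair \<mu> x \<longrightarrow> (\<Sum>i\<in>UNIV. \<mu> $ i / x $ i * P $ i) \<le> (\<mu> \<bullet> b) / 2)"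
proof
  assume "feasible P"
  then show "\<forall>\<mu> x. dual_pair \<mu> x \<longrightarrow> (\<Sum>i\<in>UNIV. \<mu> $ i / x $ i * P $ i) \<le> (\<mu> \<bullet> b) / 2"
    using dual_pair_demand_bound(1) unfolding feasible_def by blast
next
  assume dual: "\<forall>\<mu> x. dual_pair \<mu> x \<longrightarrow> (\<Sum>i\<in>UNIV. \<mu> $ i / x $ i * P $ i) \<le> (\<mu> \<bullet> b) / 2"
  show "feasible P"
  proof (rule ccontr)
    assume inf: "\<not> feasible P"
    let ?T = "{t. 0 \<le> t \<and> feasible (t *\<^sub>R P)}"
    \<comment> \<open>A feasible \<open>t *\<^sub>R P\<close> with \<open>t \<ge> 1\<close> would
      dominate \<open>P\<close> and so make \<open>P\<close> feasible.\<close>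
    have lt1: "t < 1" if "t \<in> ?T" for t
    proof (rule ccontr)
      assume "\<not> t < 1"
      obtain y where y: "\<And>i. 0 < y $ i" "demand y = t *\<^sub>R P" using \<open>t \<in> ?T\<close> by (auto simp: feasible_def)
      have "P $ i \<le> demand y $ i" for i
        using P[of i] \<open>\<not> t < 1\<close> mult_right_mono[of 1 t "P $ i"] by (simp add: y(2))
      then show False using feasible_if_le_demand[OF y(1)] inf by blast
    qed
    define s where "s = Sup ?T"
    have "?T \<noteq> {}" "bdd_above ?T"
      using feasible_zero lt1 by (auto intro!: exI[of _ 0] bdd_aboveI[of _ 1] less_imp_le)
    then have sT: "s \<in> ?T"
      unfolding s_def by (rule closed_contains_Sup[OF _ _ closed_feasible_ray[OF P]])
    have sub: "t \<le> s" if "t \<in> ?T" for t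
      unfolding s_def using that \<open>bdd_above ?T\<close> by (rule cSup_upper)
    obtain x where x: "\<And>i. 0 < x $ i" "demand x = s *\<^sub>R P" using sT by (auto simp: feasible_def)
    \<comment> \<open>A strictly larger feasible demand would leave room for
      \<open>(s + e) *\<^sub>R P\<close>, beyond the supremum \<open>s\<close>.\<close>
    have "\<nexists>y. \<forall>i. 0 < y $ i \<and> demand x $ i < demand y $ i"
    proof
      assume "\<exists>y. \<forall>i. 0 < y $ i \<and> demand x $ i < demand y $ i"
      then obtain y where y: "\<And>i. 0 < y $ i" "\<And>i. 0 < (demand y - demand x) $ i" by auto
      obtain e where e: "0 < e" "\<And>i. e * P $ i < (demand y - demand x) $ i"
        using uniform_small_step[OF y(2), of P] by auto
      have "((s + e) *\<^sub>R P) $ i \<le> demand y $ i" for i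
        using e(2)[of i] by (simp add: x(2) algebra_simps)
      then have "s + e \<in> ?T" using feasible_if_le_demand[OF y(1)] sT e(1) by auto
      then show False using sub e(1) by fastforce
    qed
    moreover have "0 \<le> demand x $ i" for i using P sT by (simp add: x(2))
    ultimately obtain \<mu> where \<mu>: "dual_pair \<mu> x" using dual_pair_if_not_dominated[OF x(1)] by blast
    let ?S = "\<Sum>i\<in>UNIV. \<mu> $ i / x $ i * P $ i"
    have "s * ?S = (\<mu> \<bullet> b) / 2"
      using dual_pair_demand_bound(2)[OF \<mu>] by (simp add: x(2) sum_distrib_left algebra_simps)
    moreover have "0 \<le> ?S" using \<mu> P unfolding dual_pair_def
      by (intro sum_nonneg mult_nonneg_nonneg divide_nonneg_pos) (auto simp: less_imp_le)
    moreover have "?S \<le> (\<mu> \<bullet> b) / 2" using dual \<mu> by blast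
    \<comment> \<open>The assumed bound reads \<open>?S \<le> s * ?S\<close>, while
      \<open>s * ?S\<close> is positive.\<close>
    ultimately have "(1 - s) * ?S \<le> 0" "?S \<noteq> 0"
      using dual_pair_inner_pos[OF \<mu>] by (auto simp: algebra_simps)
    then show False using lt1[OF sT] \<open>0 \<le> ?S\<close> by (simp add: mult_le_0_iff)
  qed
qed

theorem feasible_interior_iff_dual:
  assumes P: "\<And>i. 0 \<le> P $ i"
  shows "P \<in> interior {p. feasible p} \<longleftrightarrow>
    (\<forall>\<mu> x. dual_pair \<mu> x \<longrightarrow> (\<Sum>i\<in>UNIV. \<mu> $ i / x $ i * P $ i) < (\<mu> \<bullet> b) / 2)"
proof
  assume int: "P \<in> interior {p. feasible p}"
  \<comment> \<open>An interior point can be raised in every entry and stay feasible; as the weights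
    \<open>\<mu> $ i / x $ i\<close> are positive, the bound at the raised demand is strict at
    \<open>P\<close>.\<close>
  have "((\<lambda>e. P + e *\<^sub>R 1) \<longlongrightarrow> P + 0 *\<^sub>R 1) (at_right 0)" by (intro tendsto_intros)
  then have "\<forall>\<^sub>F e in at_right 0. P + e *\<^sub>R 1 \<in> interior {p. feasible p} \<and> 0 < e"
    using int by (intro eventually_conj eventually_at_right_less topological_tendstoD) auto
  then obtain e :: real where e: "P + e *\<^sub>R 1 \<in> interior {p. feasible p}" "0 < e"
    by (metis (lifting) eventually_happens trivial_limit_at_right_real)
  then have "feasible (P + e *\<^sub>R 1)" using interior_subset by blast
  then obtain y where y: "demand y = P + e *\<^sub>R 1" by (auto simp: feasible_def)
  show "\<forall>\<mu> x. dual_pair \<mu> x \<longrightarrow> (\<Sum>i\<in>UNIV. \<mu> $ i / x $ i * P $ i) < (\<mu> \<bullet> b) / 2"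
  proof (intro allI impI)
    fix \<mu> x assume d: "dual_pair \<mu> x"
    have "(\<Sum>i\<in>UNIV. \<mu> $ i / x $ i * P $ i) < (\<Sum>i\<in>UNIV. \<mu> $ i / x $ i * demand y $ i)"
      using d e(2) by (intro sum_strict_mono mult_strict_left_mono) (auto simp: y dual_pair_def)
    then show "(\<Sum>i\<in>UNIV. \<mu> $ i / x $ i * P $ i) < (\<mu> \<bullet> b) / 2"
      using dual_pair_demand_bound(1)[OF d, of y] by linarith
  qed
next
  assume dual: "\<forall>\<mu> x. dual_pair \<mu> x \<longrightarrow> (\<Sum>i\<in>UNIV. \<mu> $ i / x $ i * P $ i) < (\<mu> \<bullet> b) / 2"
  then have "feasible P" using feasible_iff_dual[OF P] less_imp_le by blast
  then obtain x where x: "\<And>i. 0 < x $ i" "demand x = P" by (auto simp: feasible_def)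
  \<comment> \<open>Otherwise \<open>x\<close> belongs to a dual pair, for which \<open>P\<close>
    attains equality.\<close>
  have "\<exists>y. \<forall>i. 0 < y $ i \<and> demand x $ i < demand y $ i"
  proof (rule ccontr)
    assume "\<not> ?thesis"
    then obtain \<mu> where "dual_pair \<mu> x" using dual_pair_if_not_dominated[OF x(1)] P x(2) by blast
    then show False using dual dual_pair_demand_bound(2) x(2) by fastforce
  qed
  then obtain y where y: "\<And>i. 0 < y $ i" "\<And>i. P $ i < demand y $ i" using x(2) by auto
  \<comment> \<open>An open neighbourhood of \<open>P\<close> consisting of demands dominated by a
    feasible one.\<close>
  let ?U = "{p. \<forall>i. p $ i < demand y $ i}"
  have "open ?U"
    unfolding Collect_all_eq by (intro open_INT ballI open_Collect_less continuous_intros) auto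
  moreover have "feasible p" if "p \<in> ?U" for p
    using feasible_if_le_demand[OF y(1), of p] that by (simp add: less_imp_le)
  then have "?U \<subseteq> {p. feasible p}" by blast
  moreover have "P \<in> ?U" using y(2) by simp
  ultimately show "P \<in> interior {p. feasible p}" using interior_maximal by blast
qed

end

subsection \<open>Kirchhoff matrices and DC grids\<close>

lemma kirchhoff_matrix_properties:
  fixes Y :: "real ^ 'v::finite ^ 'v"
  assumes "kirchhoff_matrix Y"
  shows "transpose Y = Y" "Z_matrix Y" "irreducible_matrix Y" "(\<Sum>j\<in>UNIV. Y $ i $ j) = 0"
proof -
  obtain E w where Y: "Y = weighted_laplacian E w" and sym: "sym E" and irr: "irrefl E"
    and w: "\<And>i j. (i, j) \<in> E \<Longrightarrow> 0 < w i j \<and> w i j = w j i" and conn: "\<And>i j. (i, j) \<in> E\<^sup>*"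
    using assms unfolding kirchhoff_matrix_def connected_weighted_graph_def by blast
  have entry: "Y $ i $ j = (if (i, j) \<in> E then - w i j else 0)" if "i \<noteq> j" for i j
    using that by (simp add: Y weighted_laplacian_def)
  have "Y $ i $ j = Y $ j $ i" for i j
    using entry[of i j] entry[of j i] w symD[OF sym] by (cases "i = j") auto
  then show "transpose Y = Y" by (simp add: transpose_def vec_eq_iff)
  show "Z_matrix Y" using entry w by (auto simp: Z_matrix_def less_imp_le)
  show "irreducible_matrix Y"
    unfolding irreducible_matrix_def
  proof (intro notI, elim exE conjE)
    fix S assume S: "S \<noteq> {}" "S \<noteq> UNIV" "\<forall>i\<in>S. \<forall>j\<in>- S. Y $ i $ j = 0"
    then obtain a c where ac: "a \<in> S" "c \<notin> S" by blast
    have "(a, c) \<in> E\<^sup>*" by (rule conn)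
    \<comment> \<open>A path that starts in \<open>S\<close> cannot leave it, since every edge is a
      nonzero entry of \<open>Y\<close>.\<close>
    then have "c \<in> S"
    proof (induction rule: rtrancl_induct)
      case (step y z)
      show ?case
      proof (rule ccontr)
        assume "z \<notin> S"
        then have "y \<noteq> z" "Y $ y $ z = 0" using step.IH S(3) by auto
        then show False using entry[of y z] step.hyps(2) w by force
      qed
    qed (rule ac)
    then show False using ac by blast
  qed
  have "(\<Sum>j\<in>UNIV. Y $ i $ j) = Y $ i $ i + (\<Sum>j\<in>UNIV - {i}. Y $ i $ j)"
    by (simp add: sum.remove)
  also have "(\<Sum>j\<in>UNIV - {i}. Y $ i $ j) = (\<Sum>j\<in>UNIV - {i}. if (i, j) \<in> E then - w i j else 0)"
    using entry by (intro sum.cong) auto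
  also have "\<dots> = (\<Sum>j | (i, j) \<in> E. - w i j)"
    using irr by (intro sum.mono_neutral_cong_right) (auto simp: irrefl_def)
  finally show "(\<Sum>j\<in>UNIV. Y $ i $ j) = 0"
    by (simp add: Y weighted_laplacian_def sum_negf)
qed

text \<open>Nonzero because irreducibility of \<open>Y\<close> gives an edge from some load to some
  source, where a positive voltage injects current.\<close>

lemma kirchhoff_injected_current:
  fixes Y :: "real ^ ('n::finite + 'm::finite) ^ ('n + 'm)"
  assumes Y: "kirchhoff_matrix Y" and V: "\<And>k. 0 < V $ k"
  shows "0 \<le> I_L_star Y V $ i" "I_L_star Y V \<noteq> 0"
proof -
  have Z: "Y $ Inl i $ Inr k \<le> 0" for i k
    using kirchhoff_matrix_properties(2)[OF Y] by (simp add: Z_matrix_def)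
  have nonneg: "0 \<le> - (Y $ Inl i $ Inr k * V $ k)" for i k
    using Z[of i k] V[of k] by (simp add: mult_nonpos_nonneg less_imp_le)
  have eq: "I_L_star Y V $ i = (\<Sum>k\<in>UNIV. - (Y $ Inl i $ Inr k * V $ k))" for i
    by (simp add: I_L_star_def Y_LS_def matrix_vector_mult_def sum_negf)
  show "0 \<le> I_L_star Y V $ i" unfolding eq using nonneg by (rule sum_nonneg)
  let ?S = "range Inl :: ('n + 'm) set"
  have "Inr undefined \<notin> ?S" by blast
  then have "?S \<noteq> UNIV" by (metis UNIV_I)
  moreover have "?S \<noteq> {}" by simp
  ultimately obtain u v where uv: "u \<in> ?S" "v \<notin> ?S" "Y $ u $ v \<noteq> 0"
    using irreducible_matrixD[OF kirchhoff_matrix_properties(3)[OF Y], of ?S] by metis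
  then obtain j where j: "u = Inl j" by blast
  obtain k where k: "v = Inr k" using uv(2) by (cases v) auto
  have "Y $ Inl j $ Inr k < 0" using Z[of j k] uv(3) j k by simp
  then have "0 < - (Y $ Inl j $ Inr k * V $ k)" using V by (simp add: mult_neg_pos)
  then have "0 < I_L_star Y V $ j"
    unfolding eq using nonneg by (intro sum_pos2[of UNIV k]) auto
  then show "I_L_star Y V \<noteq> 0" by auto
qed

lemma kirchhoff_load_block_stieltjes:
  fixes Y :: "real ^ ('n::finite + 'm::finite) ^ ('n + 'm)"
  assumes Y: "kirchhoff_matrix Y" and irr: "irreducible_matrix (Y_LL Y)"
  shows "irreducible_stieltjes (Y_LL Y)"
proof -
  have "transpose (Y_LL Y) = Y_LL Y"
    using kirchhoff_matrix_properties(1)[OF Y] by (simp add: vec_eq_iff transpose_def Y_LL_def)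
  moreover have "Z_matrix (Y_LL Y)"
    using kirchhoff_matrix_properties(2)[OF Y] by (simp add: Z_matrix_def Y_LL_def)
  \<comment> \<open>Zero row sums turn the all-ones vector into a positive supersolution: its image
    is the current injected by unit source voltages, nonnegative and nonzero.\<close>
  moreover have "Y_LL Y *v 1 = I_L_star Y 1"
  proof -
    have "(\<Sum>j\<in>UNIV. Y $ i $ Inl j) + (\<Sum>k\<in>UNIV. Y $ i $ Inr k) = 0" for i
      using kirchhoff_matrix_properties(4)[OF Y, of i] sum.Plus[of UNIV UNIV "\<lambda>j. Y $ i $ j"]
      by simp
    then show ?thesis
      by (simp add: vec_eq_iff I_L_star_def Y_LS_def Y_LL_def matrix_vector_mult_def eq_neg_iff_add_eq_0)
  qed
  ultimately show ?thesis
    using irr kirchhoff_injected_current[OF Y, of 1]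
      irreducible_Z_matrix_positive_definite[of "Y_LL Y" 1]
    by (simp add: irreducible_stieltjes_def)
qed

locale dc_grid =
  fixes Y :: "real ^ ('n::finite + 'm::finite) ^ ('n + 'm)" and V_S :: "real ^ 'm"
  assumes Y: "kirchhoff_matrix Y" and irr: "irreducible_matrix (Y_LL Y)" and V_S: "\<And>k. 0 < V_S $ k"
begin

sublocale power_flow "Y_LL Y" "I_L_star Y V_S"
  using kirchhoff_load_block_stieltjes[OF Y irr] kirchhoff_injected_current[OF Y V_S]
  by unfold_locales

section \<open>Translation between the grid and dual pairs\<close>

lemma V_L_star_eq: "Y_LL Y *v V_L_star Y V_S = I_L_star Y V_S"
  unfolding V_L_star_def using A_solve matrix_inv_eqI[OF A_inv] by metis

lemma feasible_demands_eq: "feasible_demands Y V_S = {p. feasible p}"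
proof -
  have "P_c Y V_S x = demand x" for x
    by (simp add: P_c_def vec_eq_iff demand_nth matrix_vector_mult_diff_distrib V_L_star_eq right_diff_distrib)
  then show ?thesis by (auto simp: feasible_demands_def feasible_def)
qed

lemma nonneg_vecs_1_iff: "\<nu> \<in> nonneg_vecs_1 \<longleftrightarrow> (\<forall>i. 0 \<le> \<nu> $ i) \<and> 1 \<bullet> \<nu> = 1"
  by (simp add: nonneg_vecs_1_def nonneg_vecs_def less_eq_vec_def)

text \<open>Factors out a positive diagonal so that, for \<open>Y_LL Y *v \<mu> \<ge> 0\<close>, the
  other factor is a Stieltjes matrix.\<close>

lemma g_mat_eq:
  assumes "\<And>i. 0 < \<mu> $ i"
  shows "g_mat Y \<mu> = diag \<mu> ** (Y_LL Y + diag (\<chi> i. (Y_LL Y *v \<mu>) $ i / \<mu> $ i))"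
  using assms by (simp add: g_mat_def matrix_eq vec_eq_iff matrix_vector_mult_add_rdistrib
      less_imp_neq[THEN not_sym] algebra_simps flip: matrix_vector_mul_assoc)

text \<open>With \<open>\<mu>\<close> the preimage of \<open>\<nu>\<close> under
  \<open>Y_LL Y\<close>, the factorisation of \<open>g_mat\<close> shows that it is an invertible
  M-matrix and reduces the definition of \<open>psi\<close> to
  \<open>B *v x = I_L_star Y V_S\<close>. Positivity of \<open>x\<close> is then the maximum
  principle for \<open>B\<close>.\<close>

lemma dual_pair_exists:
  assumes \<nu>: "\<nu> \<in> nonneg_vecs_1"
  obtains \<mu> x where "dual_pair \<mu> x" "Y_LL Y *v \<mu> = \<nu>" "matrix_inv (Y_LL Y) *v \<nu> = \<mu>"
    "psi Y V_S \<mu> = x"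
    "matrix_inv (diag \<mu> + matrix_inv (Y_LL Y) ** diag \<nu>) *v V_L_star Y V_S = (\<chi> i. x $ i / \<mu> $ i)"
proof -
  have \<nu>_nonneg: "0 \<le> \<nu> $ i" and \<nu>_sum: "1 \<bullet> \<nu> = 1" for i
    using \<nu> by (auto simp: nonneg_vecs_1_iff)
  obtain \<mu> where \<mu>: "Y_LL Y *v \<mu> = \<nu>" by (rule A_solve)
  then have "\<mu> \<noteq> 0" using \<nu>_sum by auto
  then have \<mu>_pos: "0 < \<mu> $ i" for i
    using irreducible_stieltjes_pos[OF A] \<mu> \<nu>_nonneg by metis
  then have \<mu>_nz: "\<mu> $ i \<noteq> 0" for i by (metis less_irrefl)
  define B where "B = Y_LL Y + diag (\<chi> i. \<nu> $ i / \<mu> $ i)"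
  have B: "irreducible_stieltjes B"
    unfolding B_def using \<mu>_pos \<nu>_nonneg by (intro irreducible_stieltjes_add_diag[OF A]) (simp add: less_imp_le)
  have B_inv: "invertible B" by (rule irreducible_stieltjes_invertible[OF B])
  obtain x where x: "B *v x = I_L_star Y V_S"
    using B_inv by (metis invertible_def matrix_vector_mul_assoc matrix_vector_mul_lid)
  then have "x \<noteq> 0" using b_nonzero by auto
  then have x_pos: "0 < x $ i" for i
    using irreducible_stieltjes_pos[OF B] x b_nonneg by metis
  have x_eq: "(Y_LL Y *v x) $ i + \<nu> $ i / \<mu> $ i * x $ i = I_L_star Y V_S $ i" for i
    using x[THEN arg_cong[where f="\<lambda>v. v $ i"]] by (simp add: B_def matrix_vector_mult_add_rdistrib)
  have "\<mu> $ i * (Y_LL Y *v x) $ i + \<nu> $ i * x $ i = \<mu> $ i * I_L_star Y V_S $ i" for i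
    using \<mu>_nz[of i] x_eq[of i, symmetric] by (simp add: field_simps)
  then have dual: "dual_pair \<mu> x"
    using \<mu>_pos x_pos \<mu> \<nu>_nonneg \<nu>_sum by (simp add: dual_pair_def)
  have g: "g_mat Y \<mu> = diag \<mu> ** B"
    using g_mat_eq[OF \<mu>_pos] by (simp add: \<mu> B_def)
  have g_inv: "invertible (g_mat Y \<mu>)"
    unfolding g using diag_cancel(1)[OF \<mu>_nz] B_inv by (rule invertible_mult)
  have "psi Y V_S \<mu> = matrix_inv (g_mat Y \<mu>) *v (diag \<mu> *v I_L_star Y V_S)"
    using g_inv M_matrix_diag_mult_stieltjes[OF B \<mu>_pos] by (simp add: psi_def g)
  also have "\<dots> = x"
    by (rule matrix_inv_eqI[OF g_inv]) (simp add: g x flip: matrix_vector_mul_assoc)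
  finally have psi: "psi Y V_S \<mu> = x" .
  let ?M = "diag \<mu> + matrix_inv (Y_LL Y) ** diag \<nu>"
  \<comment> \<open>Moves \<open>Y_LL\<close> across the explicit matrix, so that inverting
    \<open>?M\<close> at \<open>V_L_star\<close> becomes solving with \<open>B\<close> and dividing
    by \<open>\<mu>\<close>.\<close>
  have "Y_LL Y ** ?M = B ** diag \<mu>"
  proof -
    have "Y_LL Y *v (matrix_inv (Y_LL Y) *v y) = y" for y
      using A_solve matrix_inv_eqI[OF A_inv] by metis
    then show ?thesis
      using \<mu>_nz by (simp add: matrix_eq vec_eq_iff B_def matrix_vector_mult_add_rdistrib
          matrix_vector_right_distrib flip: matrix_vector_mul_assoc)
  qed
  then have M: "Y_LL Y *v (?M *v y) = B *v (diag \<mu> *v y)" for y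
    by (simp add: matrix_vector_mul_assoc)
  have M_inv: "invertible ?M"
  proof -
    have "y = 0" if "?M *v y = 0" for y
    proof -
      have "B *v (diag \<mu> *v y) = B *v 0" using that M[of y] by simp
      then have "diag \<mu> *v y = 0" using matrix_inv_eqI[OF B_inv] by metis
      then show "y = 0" using \<mu>_nz by (simp add: vec_eq_iff)
    qed
    then show ?thesis using invertible_left_inverse matrix_left_invertible_ker by blast
  qed
  have "diag \<mu> *v (\<chi> i. x $ i / \<mu> $ i) = x" using \<mu>_nz by (simp add: vec_eq_iff)
  then have "Y_LL Y *v (?M *v (\<chi> i. x $ i / \<mu> $ i)) = Y_LL Y *v V_L_star Y V_S"
    by (simp add: M x V_L_star_eq)
  then have "?M *v (\<chi> i. x $ i / \<mu> $ i) = V_L_star Y V_S"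
    using matrix_inv_eqI[OF A_inv] by metis
  then show ?thesis
    using that[OF dual \<mu> matrix_inv_eqI[OF A_inv \<mu>] psi] matrix_inv_eqI[OF M_inv] by blast
qed

text \<open>The difference of two solutions is mapped by \<open>Y_LL\<close> to a nonpositive
  diagonal multiple of itself, so positive definiteness makes it zero.\<close>

lemma dual_pair_unique:
  assumes "dual_pair \<mu> x" "dual_pair \<mu> y" shows "x = y"
proof -
  let ?d = "x - y"
  have d: "(Y_LL Y *v ?d) $ i = - ((Y_LL Y *v \<mu>) $ i * ?d $ i / \<mu> $ i)" and "0 \<le> (Y_LL Y *v \<mu>) $ i"
    "0 < \<mu> $ i" for i
  proof -
    have \<mu>: "0 < \<mu> $ i" using assms by (simp add: dual_pair_def)
    have "\<mu> $ i * (Y_LL Y *v ?d) $ i + (Y_LL Y *v \<mu>) $ i * ?d $ i = 0"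
    proof -
      have "\<mu> $ i * (Y_LL Y *v x) $ i + (Y_LL Y *v \<mu>) $ i * x $ i = \<mu> $ i * I_L_star Y V_S $ i"
        "\<mu> $ i * (Y_LL Y *v y) $ i + (Y_LL Y *v \<mu>) $ i * y $ i = \<mu> $ i * I_L_star Y V_S $ i"
        using assms by (simp_all add: dual_pair_def)
      then show ?thesis by (simp add: matrix_vector_mult_diff_distrib right_diff_distrib)
    qed
    then show "(Y_LL Y *v ?d) $ i = - ((Y_LL Y *v \<mu>) $ i * ?d $ i / \<mu> $ i)"
      using \<mu> by (simp add: field_simps)
  qed (use assms in \<open>simp_all add: dual_pair_def\<close>)
  then have "0 \<le> (Y_LL Y *v \<mu>) $ i * (?d $ i * ?d $ i) / \<mu> $ i" for i
    by (intro divide_nonneg_pos mult_nonneg_nonneg[OF _ zero_le_square])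
  then have "0 \<le> ?d $ i * ((Y_LL Y *v \<mu>) $ i * ?d $ i / \<mu> $ i)" for i
    by (simp add: mult_ac)
  then have "?d \<bullet> (Y_LL Y *v ?d) \<le> 0"
    unfolding inner_sum by (intro sum_nonpos) (simp add: d)
  then have "?d = 0" using A unfolding irreducible_stieltjes_def by (meson not_le)
  then show ?thesis by simp
qed

text \<open>Both left-hand sides become the same weighted sum because \<open>psi\<close> at
  \<open>\<mu>\<close> is \<open>x\<close>, by uniqueness. The right-hand sides agree by moving
  \<open>Y_LL\<close> from \<open>\<mu>\<close> onto \<open>V_L_star\<close>.\<close>

lemma dual_pair_inequality_terms:
  assumes d: "dual_pair \<mu> x"
  defines "\<nu> \<equiv> Y_LL Y *v \<mu>"
  shows "\<nu> \<in> nonneg_vecs_1"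
    and "chi Y V_S \<nu> \<bullet> P = (\<Sum>i\<in>UNIV. \<mu> $ i / x $ i * P $ i)"
    and "1 \<bullet> (matrix_inv (diag (matrix_inv (diag (matrix_inv (Y_LL Y) *v \<nu>) +
           matrix_inv (Y_LL Y) ** diag \<nu>) *v V_L_star Y V_S)) *v P) = (\<Sum>i\<in>UNIV. \<mu> $ i / x $ i * P $ i)"
    and "1/2 * (\<nu> \<bullet> V_L_star Y V_S) = (\<mu> \<bullet> I_L_star Y V_S) / 2"
proof -
  show \<nu>: "\<nu> \<in> nonneg_vecs_1" using d by (simp add: \<nu>_def nonneg_vecs_1_iff dual_pair_def)
  obtain \<mu>' x' where dual: "dual_pair \<mu>' x'" "Y_LL Y *v \<mu>' = \<nu>" "matrix_inv (Y_LL Y) *v \<nu> = \<mu>'"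
    "psi Y V_S \<mu>' = x'"
    "matrix_inv (diag \<mu>' + matrix_inv (Y_LL Y) ** diag \<nu>) *v V_L_star Y V_S = (\<chi> i. x' $ i / \<mu>' $ i)"
    using dual_pair_exists[OF \<nu>] .
  have \<mu>': "\<mu>' = \<mu>" using dual(3) matrix_inv_eqI[OF A_inv] by (simp add: \<nu>_def)
  then have x': "x' = x" using dual_pair_unique dual(1) d by blast
  have nz: "\<mu> $ i \<noteq> 0" "x $ i \<noteq> 0" for i using d by (auto simp: dual_pair_def) (metis less_irrefl)+
  show "chi Y V_S \<nu> \<bullet> P = (\<Sum>i\<in>UNIV. \<mu> $ i / x $ i * P $ i)"
    using dual(3,4) nz by (simp add: chi_def \<mu>' x' diag_cancel(2) inner_sum)
  show "1 \<bullet> (matrix_inv (diag (matrix_inv (diag (matrix_inv (Y_LL Y) *v \<nu>) +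
           matrix_inv (Y_LL Y) ** diag \<nu>) *v V_L_star Y V_S)) *v P) = (\<Sum>i\<in>UNIV. \<mu> $ i / x $ i * P $ i)"
    unfolding dual(3) dual(5) using nz by (simp add: \<mu>' x' diag_cancel(2) inner_sum mult.commute)
  show "1/2 * (\<nu> \<bullet> V_L_star Y V_S) = (\<mu> \<bullet> I_L_star Y V_S) / 2"
    using A_self_adjoint[of \<mu> "V_L_star Y V_S"] by (simp add: \<nu>_def V_L_star_eq)
qed

text \<open>The relation \<open>Q\<close> is left open so that the weak and the strict inequality
  are both instances.\<close>

lemma all_nonneg_vecs_1_iff_all_dual_pairs:
  "(\<forall>\<nu>\<in>nonneg_vecs_1. Q (chi Y V_S \<nu> \<bullet> P) (1/2 * (\<nu> \<bullet> V_L_star Y V_S))) \<longleftrightarrow>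
   (\<forall>\<mu> x. dual_pair \<mu> x \<longrightarrow> Q (\<Sum>i\<in>UNIV. \<mu> $ i / x $ i * P $ i) ((\<mu> \<bullet> I_L_star Y V_S) / 2))"
  (is "?l \<longleftrightarrow> ?r")
proof
  show ?r if ?l
  proof (intro allI impI)
    fix \<mu> x assume d: "dual_pair \<mu> x"
    show "Q (\<Sum>i\<in>UNIV. \<mu> $ i / x $ i * P $ i) ((\<mu> \<bullet> I_L_star Y V_S) / 2)"
      using bspec[OF that dual_pair_inequality_terms(1)[OF d]]
      unfolding dual_pair_inequality_terms(2,4)[OF d] .
  qed
  show ?l if ?r
  proof
    fix \<nu> :: "real ^ 'n" assume "\<nu> \<in> nonneg_vecs_1"
    then obtain \<mu> x where d: "dual_pair \<mu> x" and \<nu>: "Y_LL Y *v \<mu> = \<nu>"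
      by (rule dual_pair_exists)
    show "Q (chi Y V_S \<nu> \<bullet> P) (1/2 * (\<nu> \<bullet> V_L_star Y V_S))"
      unfolding \<nu>[symmetric] dual_pair_inequality_terms(2,4)[OF d] using that d by blast
  qed
qed

end

theorem theorem3p15:
  fixes Y :: "real ^ ('n::finite + 'm::finite) ^ ('n + 'm)"
    and V_S :: "real ^ 'm"
    and P :: "real ^ 'n"
  assumes "kirchhoff_matrix Y"
    and "irreducible_matrix (Y_LL Y)"
    and "\<forall>i. 0 < V_S $ i"
    and "P \<in> nonneg_vecs"
  shows "(P \<in> feasible_demands Y V_S \<inter> nonneg_vecs \<longleftrightarrow>
            (\<forall>\<nu>\<in>nonneg_vecs_1. chi Y V_S \<nu> \<bullet> P \<le> 1/2 * (\<nu> \<bullet> V_L_star Y V_S))) \<and>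
         (\<forall>\<nu>\<in>nonneg_vecs_1.
            chi Y V_S \<nu> \<bullet> P \<le> 1/2 * (\<nu> \<bullet> V_L_star Y V_S) \<longleftrightarrow>
            1 \<bullet> (matrix_inv (diag (matrix_inv (diag (matrix_inv (Y_LL Y) *v \<nu>) +
                                              matrix_inv (Y_LL Y) ** diag \<nu>) *v V_L_star Y V_S)) *v P)
              \<le> 1/2 * (\<nu> \<bullet> V_L_star Y V_S)) \<and>
         (P \<in> interior (feasible_demands Y V_S) \<inter> nonneg_vecs \<longleftrightarrow>
            (\<forall>\<nu>\<in>nonneg_vecs_1. chi Y V_S \<nu> \<bullet> P < 1/2 * (\<nu> \<bullet> V_L_star Y V_S)))"
proof -
  interpret dc_grid Y V_S using assms(1-3) by unfold_locales auto
  have P: "0 \<le> P $ i" for i using assms(4) by (simp add: nonneg_vecs_def less_eq_vec_def)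
  \<comment> \<open>The two left-hand sides are equal, which gives the equivalence of the
    inequalities by rewriting.\<close>
  have explicit: "chi Y V_S \<nu> \<bullet> P = 1 \<bullet> (matrix_inv (diag (matrix_inv (diag (matrix_inv (Y_LL Y) *v \<nu>) +
      matrix_inv (Y_LL Y) ** diag \<nu>) *v V_L_star Y V_S)) *v P)" if "\<nu> \<in> nonneg_vecs_1" for \<nu>
  proof -
    obtain \<mu> x where "dual_pair \<mu> x" "Y_LL Y *v \<mu> = \<nu>" using dual_pair_exists[OF \<open>\<nu> \<in> nonneg_vecs_1\<close>] .
    then show ?thesis using dual_pair_inequality_terms(2,3)[of \<mu> x P] by simp
  qed
  have feas: "P \<in> feasible_demands Y V_S \<inter> nonneg_vecs \<longleftrightarrow>
      (\<forall>\<nu>\<in>nonneg_vecs_1. chi Y V_S \<nu> \<bullet> P \<le> 1/2 * (\<nu> \<bullet> V_L_star Y V_S))"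
    unfolding all_nonneg_vecs_1_iff_all_dual_pairs[of "(\<le>)"] feasible_iff_dual[OF P, symmetric]
    using assms(4) by (simp add: feasible_demands_eq)
  have int: "P \<in> interior (feasible_demands Y V_S) \<inter> nonneg_vecs \<longleftrightarrow>
      (\<forall>\<nu>\<in>nonneg_vecs_1. chi Y V_S \<nu> \<bullet> P < 1/2 * (\<nu> \<bullet> V_L_star Y V_S))"
    unfolding all_nonneg_vecs_1_iff_all_dual_pairs[of "(<)"] feasible_interior_iff_dual[OF P, symmetric]
    using assms(4) by (simp add: feasible_demands_eq)
  show ?thesis
    by (rule conjI[OF feas conjI[OF _ int]], rule ballI) (simp only: explicit)
qed

end
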